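(* Let $M$ be an o-minimal expansion of a model of $\mathsf{MDLO}$. A set $D \subseteq M$ is definable if and only if $M \setminus D$ is a countable union of pairwise disjoint open intervals, of which only finitely many have diameter $\geq \varepsilon$ for any fixed $\varepsilon > 0$.
   Context: A metric linear order is a set with a linear order $\le$ and metric $d$ (diameter $\le1$) such that every open ball is order-convex, with ray predicate $r(x,y)=\inf_{z\le y}d(x,z)$. $\mathsf{MDLO}$ is the theory of complete metric linear orders such that for every $a$, both $\{d(a,b):b<a\}$ and $\{d(a,b):b>a\}$ are dense in $[0,1]$. An expansion $M$ (in a language containing $r$) is o-minimal if the interpretation of every definable predicate with parameters in one variable is strongly regulated, i.e. a uniform limit of functions in the $\mathbb{R}$-linear span of characteristic functions of intervals of $M$. A set $D\subseteq M$ is definable if it is nonempty, metrically closed, and $x\mapsto\inf_{y\in D}d(x,y)$ is a definable predicate (with parameters). The diameter of a set $I$ is $\sup_{x,y\in I}d(x,y)$.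
   Formalization: The set D is assumed nonempty: for D empty the complement M is itself an open interval, so the right-hand condition holds, while a definable set is by definition nonempty. *)

theory Defs
  imports "HOL-Analysis.Analysis"
begin

subsection \<open>Continuous first-order logic\<close>

text \<open>
  A continuous language: function symbols (constants are the nullary ones) and \<open>[0,1]\<close>-valued
  predicate symbols, with arities and moduli of uniform continuity. The symbol sets are explicit,
  so that a language may have no function symbols. The metric is a logical symbol.
\<close>

record ('f, 'p) lang =
  fun_syms :: "'f set"
  pred_syms :: "'p set"
  fun_arity :: "'f \<Rightarrow> nat"
  pred_arity :: "'p \<Rightarrow> nat"
  fun_modulus :: "'f \<Rightarrow> real \<Rightarrow> real"
  pred_modulus :: "'p \<Rightarrow> real \<Rightarrow> real"

definition language :: "('f, 'p) lang \<Rightarrow> bool" where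
  "language L \<longleftrightarrow>
     (\<forall>f\<in>fun_syms L. \<forall>e\<in>{0<..1}. fun_modulus L f e \<in> {0<..1}) \<and>
     (\<forall>p\<in>pred_syms L. \<forall>e\<in>{0<..1}. pred_modulus L p e \<in> {0<..1})"

record ('f, 'p, 'a) struct =
  fun_int :: "'f \<Rightarrow> 'a list \<Rightarrow> 'a"
  pred_int :: "'p \<Rightarrow> 'a list \<Rightarrow> real"

text \<open>
  Tuples carry the maximum metric. Completeness and the bound on the diameter of the universe are
  not repeated here, as they are part of \<open>MDLO\<close> below.
\<close>

definition lang_structure :: "('f, 'p) lang \<Rightarrow> ('f, 'p, 'a::metric_space) struct \<Rightarrow> bool" where
  "lang_structure L M \<longleftrightarrow>
     (\<forall>f\<in>fun_syms L. \<forall>e\<in>{0<..1}. \<forall>xs ys.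
        length xs = fun_arity L f \<longrightarrow> length ys = fun_arity L f \<longrightarrow>
        (\<forall>i<fun_arity L f. dist (xs ! i) (ys ! i) < fun_modulus L f e) \<longrightarrow>
        dist (fun_int M f xs) (fun_int M f ys) \<le> e) \<and>
     (\<forall>p\<in>pred_syms L. \<forall>xs. length xs = pred_arity L p \<longrightarrow> pred_int M p xs \<in> {0..1}) \<and>
     (\<forall>p\<in>pred_syms L. \<forall>e\<in>{0<..1}. \<forall>xs ys.
        length xs = pred_arity L p \<longrightarrow> length ys = pred_arity L p \<longrightarrow>
        (\<forall>i<pred_arity L p. dist (xs ! i) (ys ! i) < pred_modulus L p e) \<longrightarrow>
        \<bar>pred_int M p xs - pred_int M p ys\<bar> \<le> e)"

datatype 'f tm = Var nat | Fn 'f "'f tm list"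

datatype ('f, 'p) fm =
    Dist "'f tm" "'f tm"
  | Pred 'p "'f tm list"
  | Conn "(nat \<Rightarrow> real) \<Rightarrow> real" "('f, 'p) fm list"
  | SupQ nat "('f, 'p) fm"
  | InfQ nat "('f, 'p) fm"

text \<open>
  \<open>[0,1]\<^sup>n\<close>, embedded in \<open>nat \<Rightarrow> real\<close> (with the product topology) by padding with zeros.
\<close>

definition cube :: "nat \<Rightarrow> (nat \<Rightarrow> real) set" where
  "cube n = {v. (\<forall>i<n. v i \<in> {0..1}) \<and> (\<forall>i\<ge>n. v i = 0)}"

definition connective :: "nat \<Rightarrow> ((nat \<Rightarrow> real) \<Rightarrow> real) \<Rightarrow> bool" where
  "connective n u \<longleftrightarrow> continuous_on (cube n) u \<and> u ` cube n \<subseteq> {0..1}"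

fun wf_tm :: "('f, 'p) lang \<Rightarrow> 'f tm \<Rightarrow> bool" where
  "wf_tm L (Var i) \<longleftrightarrow> True"
| "wf_tm L (Fn f ts) \<longleftrightarrow>
     f \<in> fun_syms L \<and> length ts = fun_arity L f \<and> (\<forall>t\<in>set ts. wf_tm L t)"

fun wf_fm :: "('f, 'p) lang \<Rightarrow> ('f, 'p) fm \<Rightarrow> bool" where
  "wf_fm L (Dist s t) \<longleftrightarrow> wf_tm L s \<and> wf_tm L t"
| "wf_fm L (Pred p ts) \<longleftrightarrow>
     p \<in> pred_syms L \<and> length ts = pred_arity L p \<and> (\<forall>t\<in>set ts. wf_tm L t)"
| "wf_fm L (Conn u \<phi>s) \<longleftrightarrow> connective (length \<phi>s) u \<and> (\<forall>\<phi>\<in>set \<phi>s. wf_fm L \<phi>)"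
| "wf_fm L (SupQ i \<phi>) \<longleftrightarrow> wf_fm L \<phi>"
| "wf_fm L (InfQ i \<phi>) \<longleftrightarrow> wf_fm L \<phi>"

fun eval_tm :: "('f, 'p, 'a) struct \<Rightarrow> (nat \<Rightarrow> 'a) \<Rightarrow> 'f tm \<Rightarrow> 'a" where
  "eval_tm M \<sigma> (Var i) = \<sigma> i"
| "eval_tm M \<sigma> (Fn f ts) = fun_int M f (map (eval_tm M \<sigma>) ts)"

fun eval_fm :: "('f, 'p, 'a::metric_space) struct \<Rightarrow> (nat \<Rightarrow> 'a) \<Rightarrow> ('f, 'p) fm \<Rightarrow> real" where
  "eval_fm M \<sigma> (Dist s t) = dist (eval_tm M \<sigma> s) (eval_tm M \<sigma> t)"
| "eval_fm M \<sigma> (Pred p ts) = pred_int M p (map (eval_tm M \<sigma>) ts)"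
| "eval_fm M \<sigma> (Conn u \<phi>s) =
     u (\<lambda>i. if i < length \<phi>s then map (\<lambda>\<phi>. eval_fm M \<sigma> \<phi>) \<phi>s ! i else 0)"
| "eval_fm M \<sigma> (SupQ i \<phi>) = (SUP a. eval_fm M (\<sigma>(i := a)) \<phi>)"
| "eval_fm M \<sigma> (InfQ i \<phi>) = (INF a. eval_fm M (\<sigma>(i := a)) \<phi>)"

text \<open>
  Definable predicates in one variable, with parameters: uniform limits of formulas. Variable 0 is
  the argument; the assignment \<open>\<sigma> n\<close> supplies the parameters of the formula \<open>\<phi> n\<close> as the
  values of its remaining free variables.
\<close>

definition definable_pred ::
    "('f, 'p) lang \<Rightarrow> ('f, 'p, 'a::metric_space) struct \<Rightarrow> ('a \<Rightarrow> real) \<Rightarrow> bool" where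
  "definable_pred L M P \<longleftrightarrow>
     (\<exists>(\<phi> :: nat \<Rightarrow> ('f, 'p) fm) (\<sigma> :: nat \<Rightarrow> nat \<Rightarrow> 'a).
        (\<forall>n. wf_fm L (\<phi> n)) \<and>
        uniform_limit UNIV (\<lambda>n x. eval_fm M ((\<sigma> n)(0 := x)) (\<phi> n)) P sequentially)"

text \<open>For nonempty \<open>D\<close>, \<open>infdist x D\<close> is the infimum of \<open>dist x y\<close> over \<open>y \<in> D\<close>.\<close>

definition definable_set ::
    "('f, 'p) lang \<Rightarrow> ('f, 'p, 'a::metric_space) struct \<Rightarrow> 'a set \<Rightarrow> bool" where
  "definable_set L M D \<longleftrightarrow> D \<noteq> {} \<and> closed D \<and> definable_pred L M (\<lambda>x. infdist x D)"

subsection \<open>Metric linear orders\<close>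

definition metric_linear_order :: "'a::{metric_space, linorder} itself \<Rightarrow> bool" where
  "metric_linear_order _ \<longleftrightarrow>
     (\<forall>x y :: 'a. dist x y \<le> 1) \<and>
     (\<forall>(a :: 'a) e. \<forall>x\<in>ball a e. \<forall>y\<in>ball a e. {x..y} \<subseteq> ball a e)"

definition ray :: "'a::{metric_space, linorder} \<Rightarrow> 'a \<Rightarrow> real" where
  "ray x y = (INF z\<in>{..y}. dist x z)"

definition MDLO :: "'a::{metric_space, linorder} itself \<Rightarrow> bool" where
  "MDLO T \<longleftrightarrow>
     metric_linear_order T \<and> complete (UNIV :: 'a set) \<and>
     (\<forall>a :: 'a. {0..1} \<subseteq> closure {dist a b |b. b < a} \<and>
                {0..1} \<subseteq> closure {dist a b |b. b > a})"

text \<open>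
  \<open>M\<close> is a structure for a language \<open>L\<close> with the binary predicate symbol \<open>r\<close>, interpreted
  as the ray predicate, and its universe is a model of \<open>MDLO\<close>.
\<close>

definition MDLO_expansion ::
    "('f, 'p) lang \<Rightarrow> 'p \<Rightarrow> ('f, 'p, 'a::{metric_space, linorder}) struct \<Rightarrow> bool" where
  "MDLO_expansion L r M \<longleftrightarrow>
     MDLO TYPE('a) \<and> language L \<and> lang_structure L M \<and>
     r \<in> pred_syms L \<and> pred_arity L r = 2 \<and> (\<forall>x y. pred_int M r [x, y] = ray x y)"

subsection \<open>O-minimality\<close>

text \<open>
  Intervals have endpoints in \<open>M \<union> {-\<infinity>, \<infinity>}\<close>; an arbitrary order-convex set need not
  be one, since the order need not be Dedekind complete.
\<close>

definition order_interval :: "'a::linorder set \<Rightarrow> bool" where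
  "order_interval I \<longleftrightarrow>
     (\<exists>a b. I = {a<..<b} \<or> I = {a..<b} \<or> I = {a<..b} \<or> I = {a..b}) \<or>
     (\<exists>a. I = {a<..} \<or> I = {a..} \<or> I = {..<a} \<or> I = {..a}) \<or>
     I = UNIV"

definition open_order_interval :: "'a::linorder set \<Rightarrow> bool" where
  "open_order_interval I \<longleftrightarrow>
     (\<exists>a b. a < b \<and> I = {a<..<b}) \<or> (\<exists>a. I = {a<..} \<or> I = {..<a}) \<or> I = UNIV"

definition interval_step_function :: "('a::linorder \<Rightarrow> real) \<Rightarrow> bool" where
  "interval_step_function g \<longleftrightarrow>
     (\<exists>F (c :: 'a set \<Rightarrow> real). finite F \<and> (\<forall>I\<in>F. order_interval I) \<and>
        g = (\<lambda>x. \<Sum>I\<in>F. c I * indicator I x))"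

definition strongly_regulated :: "('a::linorder \<Rightarrow> real) \<Rightarrow> bool" where
  "strongly_regulated f \<longleftrightarrow>
     (\<exists>g :: nat \<Rightarrow> 'a \<Rightarrow> real. (\<forall>n. interval_step_function (g n)) \<and>
        uniform_limit UNIV g f sequentially)"

definition o_minimal ::
    "('f, 'p) lang \<Rightarrow> ('f, 'p, 'a::{metric_space, linorder}) struct \<Rightarrow> bool" where
  "o_minimal L M \<longleftrightarrow> (\<forall>P. definable_pred L M P \<longrightarrow> strongly_regulated P)"

end

theory Submission
  imports Defs
begin

text \<open>
  In a model of \<open>MDLO\<close> the metric and order topologies agree and \<open>dist a\<close> is monotone on each
  side of \<open>a\<close>.

  If \<open>D\<close> is definable, its distance function is regulated, hence nearly constant on both sides of
  any unrealised cut. If such a cut bounded a convex component of \<open>- D\<close>, the distance to \<open>D\<close> would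
  tend to 0 there, so the cut would have zero metric width and be filled by completeness. Thus all
  components are intervals. A component of diameter \<open>\<ge> \<epsilon>\<close> contains a point at distance at least
  \<open>\<epsilon>/6\<close> from \<open>D\<close>, and a step function close to the distance function changes value between any
  two such components, so there are finitely many of them.

  Conversely, the distance to \<open>D\<close> is, up to \<open>\<epsilon>\<close>, the maximum over the finitely many gaps \<open>I\<close> of
  diameter \<open>\<ge> \<epsilon>\<close> of the distance to \<open>- I\<close>, which for \<open>I = (a, b)\<close> is
  \<open>min (r(x,a)) (d(x,b) - r(x,b))\<close>.
\<close>

section \<open>Metric dense linear orders\<close>

context
  assumes mdlo: "MDLO TYPE('a::{metric_space, linorder})"
begin

section \<open>Monotonicity and density of distances along the order\<close>

lemma dist_le_1: "dist x (y::'a) \<le> 1"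
  using mdlo by (simp add: MDLO_def metric_linear_order_def)

lemma bounded_mdlo: "bounded (S::'a set)"
  unfolding bounded_def using dist_le_1 by blast

text \<open>A ball around \<open>x\<close> that contains \<open>z\<close> contains all of
  \<open>{x..z}\<close> by convexity. Balls are open, so a radius slightly above
  \<open>dist x z\<close> is taken.\<close>

lemma dist_mono_right:
  fixes x y z :: 'a
  assumes "x \<le> y" "y \<le> z"
  shows "dist x y \<le> dist x z"
proof (rule field_le_epsilon)
  fix e :: real assume "e > 0"
  then have "x \<in> ball x (dist x z + e)" "z \<in> ball x (dist x z + e)"
    by (auto simp: add_nonneg_pos)
  then have "{x..z} \<subseteq> ball x (dist x z + e)"
    using mdlo unfolding MDLO_def metric_linear_order_def by blast
  then show "dist x y \<le> dist x z + e" using assms by auto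
qed

lemma dist_mono_left:
  fixes x y z :: 'a
  assumes "x \<le> y" "y \<le> z"
  shows "dist y z \<le> dist x z"
proof (rule field_le_epsilon)
  fix e :: real assume "e > 0"
  then have "x \<in> ball z (dist x z + e)" "z \<in> ball z (dist x z + e)"
    by (auto simp: add_nonneg_pos dist_commute)
  then have "{x..z} \<subseteq> ball z (dist x z + e)"
    using mdlo unfolding MDLO_def metric_linear_order_def by blast
  then show "dist y z \<le> dist x z + e" using assms by (auto simp: dist_commute)
qed

lemma dist_dense_right:
  fixes a :: 'a
  assumes "0 \<le> s" "s < t" "t \<le> 1"
  shows "\<exists>b>a. s < dist a b \<and> dist a b < t"
proof -
  \<comment> \<open>Approximating the midpoint to within half the length \<open>t - s\<close> lands
    strictly between \<open>s\<close> and \<open>t\<close>.\<close>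
  have "(s + t) / 2 \<in> closure {dist a b |b. b > a}"
    using mdlo assms unfolding MDLO_def by (auto simp: subset_eq)
  then obtain b where b: "b > a" "dist (dist a b) ((s + t) / 2) < (t - s) / 2"
    using assms(2) unfolding closure_approachable
    by (smt (verit, del_insts) divide_pos_pos mem_Collect_eq)
  then show ?thesis by (intro exI[of _ b]) (auto simp: dist_real_def abs_less_iff field_simps)
qed

lemma dist_dense_left:
  fixes a :: 'a
  assumes "0 \<le> s" "s < t" "t \<le> 1"
  shows "\<exists>b<a. s < dist a b \<and> dist a b < t"
proof -
  have "(s + t) / 2 \<in> closure {dist a b |b. b < a}"
    using mdlo assms unfolding MDLO_def by (auto simp: subset_eq)
  then obtain b where b: "b < a" "dist (dist a b) ((s + t) / 2) < (t - s) / 2"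
    using assms(2) unfolding closure_approachable
    by (smt (verit, del_insts) divide_pos_pos mem_Collect_eq)
  then show ?thesis by (intro exI[of _ b]) (auto simp: dist_real_def abs_less_iff field_simps)
qed

lemma exists_right_near:
  fixes a :: 'a
  assumes "e > 0"
  shows "\<exists>b>a. dist a b < e"
  using dist_dense_right[of 0 "min e 1" a] assms by auto

lemma exists_left_near:
  fixes a :: 'a
  assumes "e > 0"
  shows "\<exists>b<a. dist a b < e"
  using dist_dense_left[of 0 "min e 1" a] assms by auto

text \<open>Density controls only distances, but a point above \<open>a\<close> that is closer to
  \<open>a\<close> than \<open>c\<close> must lie below \<open>c\<close> by monotonicity.\<close>

lemma exists_between_right:
  fixes a c :: 'a
  assumes "a < c" "e > 0"
  shows "\<exists>b. a < b \<and> b < c \<and> dist a b < e"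
proof -
  obtain b where "b > a" "dist a b < min e (dist a c)"
    using exists_right_near[of "min e (dist a c)" a] assms by auto
  then show ?thesis using dist_mono_right[of a c b] assms
    by (metis less_imp_le min_less_iff_conj not_le)
qed

lemma exists_between_left:
  fixes a c :: 'a
  assumes "a < c" "e > 0"
  shows "\<exists>b. a < b \<and> b < c \<and> dist c b < e"
proof -
  obtain b where "b < c" "dist c b < min e (dist a c)"
    using exists_left_near[of "min e (dist a c)" c] assms by auto
  then show ?thesis using dist_mono_left[of b a c] assms
    by (metis dist_commute less_imp_le min_less_iff_conj not_le)
qed

section \<open>Order intervals in the metric topology\<close>

lemma open_greaterThan_mdlo: "open {a::'a<..}"
  unfolding open_dist
proof (intro ballI)
  fix x assume "x \<in> {a<..}"
  \<comment> \<open>A point \<open>y \<le> a\<close> would be at least as far from \<open>x\<close>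
    as \<open>a\<close> is, so \<open>dist a x\<close> serves as radius.\<close>
  then have "a < y" if "dist y x < dist a x" for y
    using dist_mono_left[of y a x] that by (metis greaterThan_iff less_imp_le not_le)
  with \<open>x \<in> {a<..}\<close> show "\<exists>e>0. \<forall>y. dist y x < e \<longrightarrow> y \<in> {a<..}"
    by (intro exI[of _ "dist a x"]) auto
qed

lemma open_lessThan_mdlo: "open {..<a::'a}"
  unfolding open_dist
proof (intro ballI)
  fix x assume "x \<in> {..<a}"
  then have "y < a" if "dist y x < dist x a" for y
    using dist_mono_right[of x a y] that by (metis dist_commute lessThan_iff less_imp_le not_le)
  with \<open>x \<in> {..<a}\<close> show "\<exists>e>0. \<forall>y. dist y x < e \<longrightarrow> y \<in> {..<a}"
    by (intro exI[of _ "dist x a"]) auto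
qed

lemma open_greaterThanLessThan_mdlo: "open {a::'a<..<b}"
  unfolding greaterThanLessThan_def by (intro open_Int open_greaterThan_mdlo open_lessThan_mdlo)

lemma open_open_order_interval: "open_order_interval (I::'a set) \<Longrightarrow> open I"
  unfolding open_order_interval_def
  using open_greaterThan_mdlo open_lessThan_mdlo open_greaterThanLessThan_mdlo by auto

lemma closure_greaterThan_mdlo:
  assumes "a < (x::'a)"
  shows "a \<in> closure {a<..<x}"
  unfolding closure_approachable
  using exists_between_right[OF assms] by (metis dist_commute greaterThanLessThan_iff)

lemma closure_lessThan_mdlo:
  assumes "x < (a::'a)"
  shows "a \<in> closure {x<..<a}"
  unfolding closure_approachable
  using exists_between_left[OF assms] by (metis dist_commute greaterThanLessThan_iff)

text \<open>On the way from \<open>x\<close> to \<open>z\<close> the interval is left through one of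
  its endpoints, and by monotonicity that endpoint is no farther from \<open>x\<close> than
  \<open>z\<close>.\<close>

lemma open_order_interval_nearest_boundary:
  fixes I :: "'a set"
  assumes "open_order_interval I" "x \<in> I" "z \<notin> I"
  shows "\<exists>e. e \<notin> I \<and> e \<in> closure I \<and> dist x e \<le> dist x z"
proof -
  have lo: ?thesis if "z \<le> a" "a < x" "a \<notin> I" "{a<..<x} \<subseteq> I" for a
    using that closure_greaterThan_mdlo[of a x] closure_mono[of "{a<..<x}" I]
      dist_mono_left[of z a x] by (metis dist_commute less_imp_le subsetD)
  have hi: ?thesis if "b \<le> z" "x < b" "b \<notin> I" "{x<..<b} \<subseteq> I" for b
    using that closure_lessThan_mdlo[of x b] closure_mono[of "{x<..<b}" I]
      dist_mono_right[of x b z] by (metis less_imp_le subsetD)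
  consider a b where "I = {a<..<b}" | a where "I = {a<..}" | b where "I = {..<b}" | "I = UNIV"
    using assms(1) unfolding open_order_interval_def by blast
  then show ?thesis
  proof cases
    case (1 a b)
    then have "z \<le> a \<or> b \<le> z" "a < x" "x < b" using assms by auto
    then show ?thesis using 1 lo[of a] hi[of b] by fastforce
  next
    case (2 a)
    then show ?thesis using assms lo[of a] by fastforce
  next
    case (3 b)
    then show ?thesis using assms hi[of b] by fastforce
  qed (use assms in auto)
qed

text \<open>
  A cut of zero metric width is realised, by completeness; this replaces the missing Dedekind
  completeness of the order.
\<close>

lemma narrow_cut_realised:
  fixes A B :: "'a set"
  assumes cut: "\<And>a b. a \<in> A \<Longrightarrow> b \<in> B \<Longrightarrow> a < b" "A \<union> B = UNIV"
    and narrow: "\<And>e. e > 0 \<Longrightarrow> \<exists>a\<in>A. \<exists>b\<in>B. dist a b < e"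
  shows "(\<exists>m\<in>A. \<forall>a\<in>A. a \<le> m) \<or> (\<exists>m\<in>B. \<forall>b\<in>B. m \<le> b)"
proof -
  have "\<forall>n. \<exists>a b. a \<in> A \<and> b \<in> B \<and> dist a b < inverse (real (Suc n))"
    using narrow by (metis inverse_positive_iff_positive of_nat_0_less_iff zero_less_Suc)
  then obtain y z where y: "\<And>n. y n \<in> A" and z: "\<And>n. z n \<in> B"
    and yz: "\<And>n. dist (y n) (z n) < inverse (real (Suc n))" by metis
  \<comment> \<open>\<open>y n\<close> is squeezed between \<open>y m\<close> and
    \<open>z m\<close>, since every \<open>z m\<close> lies above all of \<open>A\<close>.\<close>
  have step: "dist (y m) (y n) < inverse (real (Suc m))" if "y m \<le> y n" for m n
    using dist_mono_right[of "y m" "y n" "z m"] that cut(1)[OF y z, of n m] yz[of m]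
    by (meson le_less_trans less_imp_le)
  have "Cauchy y"
  proof (rule metric_CauchyI)
    fix e :: real assume "e > 0"
    then obtain N where N: "inverse (real (Suc N)) < e" using reals_Archimedean by blast
    have "dist (y m) (y n) < e" if "m \<ge> N" "n \<ge> N" for m n
    proof -
      have "inverse (real (Suc m)) \<le> inverse (real (Suc N))"
        "inverse (real (Suc n)) \<le> inverse (real (Suc N))" using that by auto
      then show ?thesis using step[of m n] step[of n m] N
        by (metis dist_commute le_cases less_le_trans less_trans)
    qed
    then show "\<exists>N. \<forall>m\<ge>N. \<forall>n\<ge>N. dist (y m) (y n) < e" by blast
  qed
  then obtain p where p: "y \<longlonglongrightarrow> p"
    using mdlo unfolding MDLO_def complete_def by blast
  have "(\<lambda>n. dist (y n) (z n)) \<longlonglongrightarrow> 0"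
  proof (rule tendsto_sandwich[OF _ _ tendsto_const LIMSEQ_inverse_real_of_nat])
    show "\<forall>\<^sub>F n in sequentially. dist (y n) (z n) \<le> inverse (real (Suc n))"
      using yz by (intro always_eventually allI less_imp_le)
  qed simp
  \<comment> \<open>By the triangle inequality the sum also bounds \<open>dist p (z n)\<close>, so
    both sides of the cut approach \<open>p\<close>.\<close>
  then have "(\<lambda>n. dist (y n) p + dist (y n) (z n)) \<longlonglongrightarrow> 0"
    using tendsto_add[of "\<lambda>n. dist (y n) p" 0 _ "\<lambda>n. dist (y n) (z n)" 0]
      tendsto_dist_iff[THEN iffD1, OF p] by simp
  from order_tendstoD(2)[OF this]
  have small: "\<exists>n. dist (y n) p + dist (y n) (z n) < e" if "e > 0" for e
    using that eventually_happens'[OF sequentially_bot] by blast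
  show ?thesis
  proof (cases "p \<in> A")
    case True
    \<comment> \<open>An \<open>a\<close> in \<open>A\<close> above \<open>p\<close> would separate
      \<open>p\<close> from every \<open>z n\<close>, although the \<open>z n\<close> come
      arbitrarily close to \<open>p\<close>.\<close>
    have "a \<le> p" if "a \<in> A" for a
    proof (rule ccontr)
      assume "\<not> a \<le> p"
      then obtain n where "dist (y n) p + dist (y n) (z n) < dist p a"
        using small[of "dist p a"] by auto
      moreover have "dist p a \<le> dist p (z n)"
        using dist_mono_right[of p a "z n"] cut(1)[OF that z] \<open>\<not> a \<le> p\<close> by (simp add: less_imp_le)
      ultimately show False using dist_triangle3[of p "z n" "y n"] by simp
    qed
    with True show ?thesis by blast
  next
    case False
    then have "p \<in> B" using cut(2) by auto
    have "p \<le> b" if "b \<in> B" for b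
    proof (rule ccontr)
      assume "\<not> p \<le> b"
      then obtain n where "dist (y n) p + dist (y n) (z n) < dist b p"
        using small[of "dist b p"] by auto
      moreover have "dist b p \<le> dist (y n) p"
        using dist_mono_left[of "y n" b p] cut(1)[OF y that] \<open>\<not> p \<le> b\<close> by (simp add: less_imp_le)
      ultimately show False using zero_le_dist[of "y n" "z n"] by linarith
    qed
    with \<open>p \<in> B\<close> show ?thesis by blast
  qed
qed

end

section \<open>Strongly regulated functions\<close>

text \<open>\<open>E\<close> cuts the order into its own points and the open pieces between them;
  related points lie in the same cell. Both comparisons are recorded to tell a point of
  \<open>E\<close> from the adjacent pieces.\<close>

definition same_side :: "'a::linorder set \<Rightarrow> 'a \<Rightarrow> 'a \<Rightarrow> bool" where
  "same_side E x y \<longleftrightarrow> (\<forall>e\<in>E. (e < x \<longleftrightarrow> e < y) \<and> (e \<le> x \<longleftrightarrow> e \<le> y))"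

lemma order_interval_same_side:
  fixes I :: "'a::linorder set"
  assumes "order_interval I"
  shows "\<exists>E. finite E \<and> (\<forall>x y. same_side E x y \<longrightarrow> (x \<in> I \<longleftrightarrow> y \<in> I))"
proof -
  have less: "x < e \<longleftrightarrow> y < e" and le: "x \<le> e \<longleftrightarrow> y \<le> e" if "same_side E x y" "e \<in> E"
    for E e and x y :: 'a
    using that unfolding same_side_def by (meson not_le)+
  consider a b where "I = {a<..<b} \<or> I = {a..<b} \<or> I = {a<..b} \<or> I = {a..b}"
    | a where "I = {a<..} \<or> I = {a..} \<or> I = {..<a} \<or> I = {..a}" | "I = UNIV"
    using assms unfolding order_interval_def by blast
  then show ?thesis
  proof cases
    case (1 a b)
    have "x \<in> I \<longleftrightarrow> y \<in> I" if "same_side {a, b} x y" for x y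
      using 1 that less[OF that, of b] le[OF that, of b] by (elim disjE) (simp_all add: same_side_def)
    then show ?thesis by (intro exI[of _ "{a, b}"]) simp
  next
    case (2 a)
    have "x \<in> I \<longleftrightarrow> y \<in> I" if "same_side {a} x y" for x y
      using 2 that less[OF that, of a] le[OF that, of a] by (elim disjE) (simp_all add: same_side_def)
    then show ?thesis by (intro exI[of _ "{a}"]) simp
  next
    case 3
    then show ?thesis by (intro exI[of _ "{}"]) auto
  qed
qed

lemma interval_step_function_same_side:
  fixes g :: "'a::linorder \<Rightarrow> real"
  assumes "interval_step_function g"
  shows "\<exists>E. finite E \<and> (\<forall>x y. same_side E x y \<longrightarrow> g x = g y)"
proof -
  obtain F and c :: "'a set \<Rightarrow> real" where F: "finite F" "\<And>I. I \<in> F \<Longrightarrow> order_interval I"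
    and g: "g = (\<lambda>x. \<Sum>I\<in>F. c I * indicator I x)"
    using assms unfolding interval_step_function_def by blast
  obtain E where E: "\<And>I. I \<in> F \<Longrightarrow> finite (E I)"
    "\<And>I x y. I \<in> F \<Longrightarrow> same_side (E I) x y \<Longrightarrow> x \<in> I \<longleftrightarrow> y \<in> I"
    using order_interval_same_side F(2) by metis
  have "g x = g y" if "same_side (\<Union>(E ` F)) x y" for x y
    unfolding g
  proof (rule sum.cong)
    fix I assume "I \<in> F"
    then have "same_side (E I) x y" using that by (auto simp: same_side_def)
    with E(2)[OF \<open>I \<in> F\<close>] show "c I * indicator I x = c I * indicator I y"
      by (simp add: indicator_def)
  qed simp
  with E(1) F(1) show ?thesis by (intro exI[of _ "\<Union>(E ` F)"]) auto
qed

text \<open>This is the form in which regulatedness is used below: a step function is constant on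
  the cells of its finitely many endpoints, and approximation within \<open>e / 2\<close> passes
  this on to \<open>f\<close> up to \<open>e\<close>.\<close>

lemma strongly_regulated_same_side:
  fixes f :: "'a::linorder \<Rightarrow> real"
  assumes "strongly_regulated f" "e > 0"
  shows "\<exists>E. finite E \<and> (\<forall>x y. same_side E x y \<longrightarrow> \<bar>f x - f y\<bar> < e)"
proof -
  obtain g :: "nat \<Rightarrow> 'a \<Rightarrow> real" where g: "\<And>n. interval_step_function (g n)"
    and lim: "uniform_limit UNIV g f sequentially"
    using assms(1) unfolding strongly_regulated_def by blast
  obtain n where n: "\<And>x. dist (g n x) (f x) < e / 2"
    using uniform_limitD[OF lim, of "e / 2"] assms(2)
    unfolding eventually_sequentially by auto
  obtain E where E: "finite E" "\<And>x y. same_side E x y \<Longrightarrow> g n x = g n y"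
    using interval_step_function_same_side[OF g] by blast
  have "\<bar>f x - f y\<bar> < e" if "same_side E x y" for x y
    using n[of x] n[of y] E(2)[OF that] unfolding dist_real_def by linarith
  with E(1) show ?thesis by blast
qed

text \<open>The finite set \<open>E\<close> from \<open>strongly_regulated_same_side\<close> can be
  passed on both sides of the cut: beyond its last point in \<open>A\<close> and before its first
  point in \<open>B\<close>, a single cell remains.\<close>

lemma strongly_regulated_near_gap:
  fixes f :: "'a::linorder \<Rightarrow> real"
  assumes "strongly_regulated f" "e > 0"
    and cut: "\<And>a b. a \<in> A \<Longrightarrow> b \<in> B \<Longrightarrow> a < b" "A \<union> B = UNIV" "A \<noteq> {}" "B \<noteq> {}"
    and gap: "\<not> (\<exists>m\<in>A. \<forall>a\<in>A. a \<le> m)" "\<not> (\<exists>m\<in>B. \<forall>b\<in>B. m \<le> b)"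
  shows "\<exists>a\<in>A. \<exists>b\<in>B. \<forall>x\<in>{a<..<b}. \<forall>y\<in>{a<..<b}. \<bar>f x - f y\<bar> < e"
proof -
  obtain E where E: "finite E" "\<And>x y. same_side E x y \<Longrightarrow> \<bar>f x - f y\<bar> < e"
    using strongly_regulated_same_side[OF assms(1,2)] by blast
  obtain a0 b0 where "a0 \<in> A" "b0 \<in> B" using cut by auto
  \<comment> \<open>\<open>a0\<close> and \<open>b0\<close> keep both sets nonempty in case
    \<open>E\<close> misses \<open>A\<close> or \<open>B\<close>.\<close>
  define a b where "a = Max (insert a0 (E \<inter> A))" and "b = Min (insert b0 (E \<inter> B))"
  have "a \<in> insert a0 (E \<inter> A)" "b \<in> insert b0 (E \<inter> B)"
    unfolding a_def b_def using E(1) by (intro Max_in Min_in; simp)+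
  then have ab: "a \<in> A" "b \<in> B" using \<open>a0 \<in> A\<close> \<open>b0 \<in> B\<close> by auto
  have side: "e \<le> a \<or> b \<le> e" if "e \<in> E" for e
  proof (cases "e \<in> A")
    case True
    then show ?thesis unfolding a_def using E(1) that by (intro disjI1 Max_ge) auto
  next
    case False
    then have "e \<in> B" using cut(2) by auto
    then show ?thesis unfolding b_def using E(1) that by (intro disjI2 Min_le) auto
  qed
  have "same_side E x y" if "x \<in> {a<..<b}" "y \<in> {a<..<b}" for x y
    unfolding same_side_def using side that by fastforce
  with ab E(2) show ?thesis by blast
qed

section \<open>Gaps of a set with regulated distance function\<close>

text \<open>For \<open>x\<close> outside \<open>D\<close> this is the convex component of
  \<open>- D\<close> around \<open>x\<close>; for \<open>x\<close> in \<open>D\<close> it is empty.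
  \<open>min\<close> and \<open>max\<close> let \<open>y\<close> lie on either side of
  \<open>x\<close>.\<close>

definition gap_component :: "'a::linorder set \<Rightarrow> 'a \<Rightarrow> 'a set" where
  "gap_component D x = {y. {min x y..max x y} \<inter> D = {}}"

lemma gap_component_self: "x \<notin> D \<Longrightarrow> x \<in> gap_component D x"
  by (simp add: gap_component_def)

lemma gap_component_disjoint: "gap_component D x \<inter> D = {}"
  by (fastforce simp: gap_component_def min_def max_def)

text \<open>Membership is symmetric, and transitive because the segment from \<open>u\<close> to
  \<open>w\<close> is covered by those from \<open>u\<close> to \<open>v\<close> and from
  \<open>v\<close> to \<open>w\<close>.\<close>

lemma gap_component_eq:
  assumes "y \<in> gap_component D x"
  shows "gap_component D x = gap_component D y"
proof -
  have trans: "w \<in> gap_component D u" if "v \<in> gap_component D u" "w \<in> gap_component D v" for u v w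
  proof -
    have "{min u w..max u w} \<subseteq> {min u v..max u v} \<union> {min v w..max v w}"
      by (auto simp: min_def max_def)
    then show ?thesis using that unfolding gap_component_def by auto
  qed
  have "x \<in> gap_component D y"
    using assms by (simp add: gap_component_def min.commute max.commute)
  with assms trans show ?thesis by blast
qed

lemma gap_component_separated:
  assumes "u \<in> gap_component D x" "v \<in> gap_component D x" "z \<in> D" "u \<le> v"
  shows "z < u \<or> v < z"
proof -
  have "v \<in> gap_component D u" using gap_component_eq assms(1,2) by blast
  then have "{u..v} \<inter> D = {}" using assms(4) by (simp add: gap_component_def)
  then show ?thesis using assms(3) by (metis atLeastAtMost_iff disjoint_iff not_le)
qed

lemma point_between_gap_components:
  assumes "u \<le> v" "v \<notin> gap_component D u"
  shows "\<exists>z\<in>D. u \<le> z \<and> z \<le> v"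
  using assms by (auto simp: gap_component_def)

section \<open>Endpoints and widths of the components of the complement\<close>

context
  fixes D :: "'a::{metric_space, linorder} set"
  assumes mdlo: "MDLO TYPE('a)" and closed: "closed D" and nonempty: "D \<noteq> {}"
    and regulated: "strongly_regulated (\<lambda>x. infdist x D)"
begin

lemma nonmember_infdist_pos: "x \<notin> D \<Longrightarrow> infdist x D > 0"
  using in_closed_iff_infdist_zero[OF closed nonempty, of x] infdist_nonneg[of x D] by linarith

lemma nonmember_ball:
  assumes "x \<notin> D"
  shows "\<exists>e>0. \<forall>y. dist x y < e \<longrightarrow> y \<notin> D"
  using nonmember_infdist_pos[OF assms] infdist_le[of _ D x] by (meson not_le)

lemma infdist_lessD: "infdist x D < e \<Longrightarrow> \<exists>z\<in>D. dist x z < e"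
  using nonempty infdist_notempty[of D x] cINF_less_iff[of D "dist x" e] by (metis bdd_below_image_dist)

text \<open>The points reached from \<open>x\<close> without meeting \<open>D\<close> form the lower
  half of a cut. If the upper half had no least element, the distance to \<open>D\<close> would be
  almost constant near the cut and vanish at points of \<open>D\<close> coinitial above it. The cut
  would then be narrow, and \<open>narrow_cut_realised\<close> would supply an endpoint after
  all.\<close>

lemma next_right:
  assumes "x \<notin> D" "d \<in> D" "x < d"
  shows "\<exists>b\<in>D. x < b \<and> {x..<b} \<inter> D = {}"
proof -
  \<comment> \<open>\<open>A\<close> also contains every \<open>y < x\<close>, as
    \<open>{x..y}\<close> is then empty; so \<open>A\<close> is a full initial segment.\<close>
  define A where "A = {y. {x..y} \<inter> D = {}}"
  define B where "B = - A"
  have xA: "x \<in> A" and dB: "d \<in> B"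
    using assms by (auto simp: A_def B_def disjoint_iff intro: less_imp_le)
  have cut: "a < b" if "a \<in> A" "b \<in> B" for a b
  proof (rule ccontr)
    assume "\<not> a < b"
    then have "{x..b} \<subseteq> {x..a}" by auto
    then show False using that unfolding A_def B_def by blast
  qed
  have un: "A \<union> B = UNIV" by (auto simp: B_def)
  have coinit: "\<exists>z\<in>D. z \<in> B \<and> z \<le> b" if "b \<in> B" for b
    using that unfolding A_def B_def by (auto simp: disjoint_iff)
  \<comment> \<open>Since \<open>D\<close> is closed, a maximum of \<open>A\<close> could be pushed
    a little to the right without meeting \<open>D\<close>.\<close>
  have nomax: "\<not> (\<exists>m\<in>A. \<forall>a\<in>A. a \<le> m)"
  proof
    assume "\<exists>m\<in>A. \<forall>a\<in>A. a \<le> m"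
    then obtain m where m: "m \<in> A" "\<And>a. a \<in> A \<Longrightarrow> a \<le> m" by blast
    have "x \<le> m" using m xA by blast
    then have "m \<notin> D" using m(1) unfolding A_def by auto
    then obtain e where e: "e > 0" "\<And>y. dist m y < e \<Longrightarrow> y \<notin> D" using nonmember_ball by blast
    obtain b where b: "b > m" "dist m b < e" using exists_right_near[OF mdlo e(1)] by blast
    have "y \<notin> D" if "m \<le> y" "y \<le> b" for y
      using dist_mono_right[OF mdlo that] b(2) e(2) by simp
    then have "b \<in> A" using m(1) unfolding A_def
      by (smt (verit, best) atLeastAtMost_iff disjoint_iff linorder_le_cases mem_Collect_eq)
    then show False using m(2) b(1) by (meson not_le)
  qed
  have "\<exists>m\<in>B. \<forall>b\<in>B. m \<le> b"
  proof (rule ccontr)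
    assume nomin: "\<not> (\<exists>m\<in>B. \<forall>b\<in>B. m \<le> b)"
    have "\<exists>a\<in>A. \<exists>b\<in>B. dist a b < e" if "e > 0" for e
    proof -
      \<comment> \<open>The bound by \<open>infdist x D\<close> prevents a point of \<open>D\<close>
        within \<open>t\<close> of a point above \<open>x\<close> from lying below \<open>x\<close>;
        so the nearby point found later is in \<open>B\<close>.\<close>
      define t where "t = min e (infdist x D)"
      have "t > 0" using that nonmember_infdist_pos[OF assms(1)] by (simp add: t_def)
      then obtain a b where ab: "a \<in> A" "b \<in> B"
        and near: "\<And>u v. u \<in> {a<..<b} \<Longrightarrow> v \<in> {a<..<b} \<Longrightarrow> \<bar>infdist u D - infdist v D\<bar> < t"
        using strongly_regulated_near_gap[OF regulated _ cut un _ _ nomax nomin] xA dB by blast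
      obtain b' where "b' \<in> B" "b' < b" using nomin ab(2) by (meson not_le)
      then obtain z where z: "z \<in> D" "z \<in> B" "z < b" using coinit by fastforce
      have "max a x \<in> A" using ab(1) xA by (simp add: max_def)
      \<comment> \<open>\<open>y\<close> lies beyond \<open>a\<close> so that it can be compared
        with \<open>z\<close>, where the distance is 0, and beyond \<open>x\<close> so that
        \<open>t\<close> excludes points of \<open>D\<close> on the far side of
        \<open>x\<close>.\<close>
      then obtain y where y: "y \<in> A" "max a x < y" using nomax by (meson not_le)
      then have "infdist y D < t"
        using near[of y z] z ab y cut[of y b] cut[of a z] by auto
      then obtain w where w: "w \<in> D" "dist y w < t" using infdist_lessD by blast
      have "w \<notin> A"
      proof
        assume "w \<in> A"
        then have "w < x" using w(1) unfolding A_def by (cases "x \<le> w") auto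
        then have "dist x w \<le> dist y w"
          using dist_mono_right[OF mdlo, of w x y] y(2) by (auto simp: dist_commute less_imp_le)
        then show False using infdist_le[OF w(1), of x] w(2) by (simp add: t_def)
      qed
      then show ?thesis using y(1) w(2) by (auto simp: t_def B_def)
    qed
    then show False
      using narrow_cut_realised[OF mdlo cut un] nomax nomin by blast
  qed
  then obtain m where m: "m \<in> B" "\<And>b. b \<in> B \<Longrightarrow> m \<le> b" by blast
  then have "m \<in> D" using coinit[OF m(1)] by (metis order_antisym)
  moreover have "{x..<m} \<inter> D = {}"
  proof (rule ccontr)
    assume "{x..<m} \<inter> D \<noteq> {}"
    then obtain z where z: "z \<in> D" "x \<le> z" "z < m" by auto
    then have "z \<in> B" unfolding A_def B_def by auto
    with m(2) z(3) show False by (meson not_le)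
  qed
  ultimately show ?thesis using cut[OF xA m(1)] by blast
qed

text \<open>Mirror image of \<open>next_right\<close>: here the final segment \<open>B\<close>
  consists of the points from which \<open>x\<close> is reached without meeting
  \<open>D\<close>.\<close>

lemma next_left:
  assumes "x \<notin> D" "d \<in> D" "d < x"
  shows "\<exists>a\<in>D. a < x \<and> {a<..x} \<inter> D = {}"
proof -
  define B where "B = {y. {y..x} \<inter> D = {}}"
  define A where "A = - B"
  have xB: "x \<in> B" and dA: "d \<in> A"
    using assms by (auto simp: A_def B_def disjoint_iff intro: less_imp_le)
  have cut: "a < b" if "a \<in> A" "b \<in> B" for a b
  proof (rule ccontr)
    assume "\<not> a < b"
    then have "{a..x} \<subseteq> {b..x}" by auto
    then show False using that unfolding A_def B_def by blast
  qed
  have un: "A \<union> B = UNIV" by (auto simp: A_def)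
  have cofin: "\<exists>z\<in>D. z \<in> A \<and> a \<le> z" if "a \<in> A" for a
    using that unfolding A_def B_def by (auto simp: disjoint_iff)
  have nomin: "\<not> (\<exists>m\<in>B. \<forall>b\<in>B. m \<le> b)"
  proof
    assume "\<exists>m\<in>B. \<forall>b\<in>B. m \<le> b"
    then obtain m where m: "m \<in> B" "\<And>b. b \<in> B \<Longrightarrow> m \<le> b" by blast
    have "m \<le> x" using m xB by blast
    then have "m \<notin> D" using m(1) unfolding B_def by auto
    then obtain e where e: "e > 0" "\<And>y. dist m y < e \<Longrightarrow> y \<notin> D" using nonmember_ball by blast
    obtain b where b: "b < m" "dist m b < e" using exists_left_near[OF mdlo e(1)] by blast
    have "y \<notin> D" if "b \<le> y" "y \<le> m" for y
      using dist_mono_left[OF mdlo that] b(2) e(2) by (simp add: dist_commute)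
    then have "b \<in> B" using m(1) unfolding B_def
      by (smt (verit, best) atLeastAtMost_iff disjoint_iff linorder_le_cases mem_Collect_eq)
    then show False using m(2) b(1) by (meson not_le)
  qed
  have "\<exists>m\<in>A. \<forall>a\<in>A. a \<le> m"
  proof (rule ccontr)
    assume nomax: "\<not> (\<exists>m\<in>A. \<forall>a\<in>A. a \<le> m)"
    have "\<exists>a\<in>A. \<exists>b\<in>B. dist a b < e" if "e > 0" for e
    proof -
      define t where "t = min e (infdist x D)"
      have "t > 0" using that nonmember_infdist_pos[OF assms(1)] by (simp add: t_def)
      then obtain a b where ab: "a \<in> A" "b \<in> B"
        and near: "\<And>u v. u \<in> {a<..<b} \<Longrightarrow> v \<in> {a<..<b} \<Longrightarrow> \<bar>infdist u D - infdist v D\<bar> < t"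
        using strongly_regulated_near_gap[OF regulated _ cut un _ _ nomax nomin] xB dA by blast
      obtain a' where "a' \<in> A" "a < a'" using nomax ab(1) by (meson not_le)
      then obtain z where z: "z \<in> D" "z \<in> A" "a < z" using cofin by fastforce
      have "min b x \<in> B" using ab(2) xB by (simp add: min_def)
      then obtain y where y: "y \<in> B" "y < min b x" using nomin by (meson not_le)
      then have "infdist y D < t"
        using near[of y z] z ab y cut[of a y] cut[of z b] by auto
      then obtain w where w: "w \<in> D" "dist y w < t" using infdist_lessD by blast
      have "w \<notin> B"
      proof
        assume "w \<in> B"
        then have "x < w" using w(1) unfolding B_def by (cases "w \<le> x") auto
        then have "dist x w \<le> dist y w"
          using dist_mono_left[OF mdlo, of y x w] y(2) by (auto simp: less_imp_le)
        then show False using infdist_le[OF w(1), of x] w(2) by (simp add: t_def)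
      qed
      then show ?thesis using y(1) w(2) by (auto simp: t_def A_def dist_commute)
    qed
    then show False
      using narrow_cut_realised[OF mdlo cut un] nomax nomin by blast
  qed
  then obtain m where m: "m \<in> A" "\<And>a. a \<in> A \<Longrightarrow> a \<le> m" by blast
  then have "m \<in> D" using cofin[OF m(1)] by (metis order_antisym)
  moreover have "{m<..x} \<inter> D = {}"
  proof (rule ccontr)
    assume "{m<..x} \<inter> D \<noteq> {}"
    then obtain z where z: "z \<in> D" "z \<le> x" "m < z" by auto
    then have "z \<in> A" unfolding A_def B_def by auto
    with m(2) z(3) show False by (meson not_le)
  qed
  ultimately show ?thesis using cut[OF m(1) xB] by blast
qed

text \<open>The neighbouring points of \<open>D\<close> given by \<open>next_left\<close> and
  \<open>next_right\<close> are the endpoints; a side without points of \<open>D\<close> is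
  unbounded.\<close>

lemma open_order_interval_gap_component:
  assumes "x \<notin> D"
  shows "open_order_interval (gap_component D x)"
proof -
  have R: "(\<exists>b\<in>D. x < b \<and> {x..<b} \<inter> D = {}) \<or> {x..} \<inter> D = {}"
    using next_right[OF assms] assms by (metis atLeast_iff disjoint_iff order_le_less)
  have L: "(\<exists>a\<in>D. a < x \<and> {a<..x} \<inter> D = {}) \<or> {..x} \<inter> D = {}"
    using next_left[OF assms] assms by (metis atMost_iff disjoint_iff order_le_less)
  \<comment> \<open>For \<open>y\<close> different from \<open>x\<close> one of the two segments is
    empty, so \<open>min\<close> and \<open>max\<close> disappear.\<close>
  have mem: "y \<in> gap_component D x \<longleftrightarrow> {x..y} \<inter> D = {} \<and> {y..x} \<inter> D = {}" for y
    using assms by (cases "x = y"; cases "x < y") (auto simp: gap_component_def min_def max_def)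
  have up: "{x..y} \<inter> D = {} \<longleftrightarrow> y < b" if "b \<in> D" "x < b" "{x..<b} \<inter> D = {}" for b y
  proof
    assume "{x..y} \<inter> D = {}"
    then show "y < b" using that(1,2) by (metis IntI atLeastAtMost_iff empty_iff less_imp_le not_le)
  next
    assume "y < b"
    then have "{x..y} \<subseteq> {x..<b}" by auto
    then show "{x..y} \<inter> D = {}" using that(3) by blast
  qed
  have down: "{y..x} \<inter> D = {} \<longleftrightarrow> a < y" if "a \<in> D" "a < x" "{a<..x} \<inter> D = {}" for a y
  proof
    assume "{y..x} \<inter> D = {}"
    then show "a < y" using that(1,2) by (metis IntI atLeastAtMost_iff empty_iff less_imp_le not_le)
  next
    assume "a < y"
    then have "{y..x} \<subseteq> {a<..x}" by auto
    then show "{y..x} \<inter> D = {}" using that(3) by blast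
  qed
  have up_all: "{x..y} \<inter> D = {}" if "{x..} \<inter> D = {}" for y
    using that by auto
  have down_all: "{y..x} \<inter> D = {}" if "{..x} \<inter> D = {}" for y
    using that by auto
  from R L consider
    a b where "a \<in> D" "b \<in> D" "a < x" "x < b" "{a<..x} \<inter> D = {}" "{x..<b} \<inter> D = {}"
    | a where "a \<in> D" "a < x" "{a<..x} \<inter> D = {}" "{x..} \<inter> D = {}"
    | b where "b \<in> D" "x < b" "{..x} \<inter> D = {}" "{x..<b} \<inter> D = {}"
    | "{..x} \<inter> D = {}" "{x..} \<inter> D = {}" by blast
  then show ?thesis
  proof cases
    case (1 a b)
    then have "gap_component D x = {a<..<b}" by (auto simp: mem up[of b] down[of a])
    moreover have "a < b" using 1 by (metis less_trans)
    ultimately show ?thesis unfolding open_order_interval_def by blast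
  next
    case (2 a)
    then have "gap_component D x = {a<..}" by (auto simp: mem up_all down[of a])
    then show ?thesis unfolding open_order_interval_def by blast
  next
    case (3 b)
    then have "gap_component D x = {..<b}" by (auto simp: mem up[of b] down_all)
    then show ?thesis unfolding open_order_interval_def by blast
  next
    case 4
    then have "gap_component D x = UNIV" by (auto simp: mem up_all down_all)
    then show ?thesis unfolding open_order_interval_def by blast
  qed
qed

text \<open>Between two points \<open>u\<close> and \<open>v\<close> of the component more than
  \<open>e / 2\<close> apart, a point at distance between \<open>e / 6\<close> and
  \<open>e / 4\<close> from \<open>u\<close> is far from both. All of \<open>D\<close> lies beyond
  \<open>u\<close> or beyond \<open>v\<close>, hence is at least as far away.\<close>

lemma wide_gap_component_deep_point:
  assumes "x \<notin> D" "e > 0" "e \<le> diameter (gap_component D x)"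
  shows "\<exists>y\<in>gap_component D x. e / 6 \<le> infdist y D"
proof -
  define C where "C = gap_component D x"
  have "C \<noteq> {}" using gap_component_self[OF assms(1)] by (auto simp: C_def)
  then have "\<exists>u\<in>C. \<exists>v\<in>C. e / 2 < dist u v"
    using assms diameter_lower_bounded[OF bounded_mdlo[OF mdlo], of "e / 2" C]
    by (auto simp: C_def)
  then have "\<exists>u\<in>C. \<exists>v\<in>C. u \<le> v \<and> e / 2 < dist u v"
    by (metis dist_commute linear)
  then obtain u v where uv: "u \<in> C" "v \<in> C" "u \<le> v" "e / 2 < dist u v" by blast
  \<comment> \<open>Density of distances is available only inside \<open>[0,1]\<close>.\<close>
  have "e / 4 \<le> 1" using uv(4) dist_le_1[OF mdlo, of u v] assms(2) by linarith
  then obtain y where y: "u < y" "e / 6 < dist u y" "dist u y < e / 4"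
    using dist_dense_right[OF mdlo, of "e / 6" "e / 4" u] assms(2) by auto
  have "y \<le> v"
  proof (rule ccontr)
    assume "\<not> y \<le> v"
    then have "dist u v \<le> dist u y" using dist_mono_right[OF mdlo uv(3), of y] by simp
    then show False using uv(4) y(3) assms(2) by linarith
  qed
  have yv: "e / 6 < dist y v" using dist_triangle[of u v y] uv(4) y(3) assms(2) by linarith
  have "e / 6 \<le> dist y z" if "z \<in> D" for z
  proof -
    have "z < u \<or> v < z" using gap_component_separated uv that unfolding C_def by blast
    then have "dist u y \<le> dist y z \<or> dist y v \<le> dist y z"
      using y(1) \<open>y \<le> v\<close> dist_mono_left[OF mdlo, of z u y] dist_mono_right[OF mdlo, of y v z]
      by (metis dist_commute less_imp_le)
    then show ?thesis using y(2) yv by linarith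
  qed
  then have "e / 6 \<le> infdist y D"
    unfolding infdist_notempty[OF nonempty] using nonempty by (intro cINF_greatest)
  moreover have "y \<in> C"
  proof -
    have "v \<in> gap_component D u" using uv gap_component_eq unfolding C_def by blast
    then have "y \<in> gap_component D u"
      using y(1) \<open>y \<le> v\<close> by (fastforce simp: gap_component_def)
    then show ?thesis using uv gap_component_eq unfolding C_def by blast
  qed
  ultimately show ?thesis unfolding C_def by blast
qed

text \<open>
  Two deep points on which the step function agrees cannot lie in different components, since a
  point of \<open>D\<close> separates them.
\<close>

lemma finite_wide_gap_components:
  assumes "e > 0"
  shows "finite {I \<in> gap_component D ` (- D). e \<le> diameter I}"
proof -
  obtain E where E: "finite E"
    and near: "\<And>x y. same_side E x y \<Longrightarrow> \<bar>infdist x D - infdist y D\<bar> < e / 6"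
    using strongly_regulated_same_side[OF regulated, of "e / 6"] assms by auto
  define W where "W = {I \<in> gap_component D ` (- D). e \<le> diameter I}"
  \<comment> \<open>Any point of a component represents it, so a deep point can be taken as
    representative.\<close>
  have "\<exists>y. I = gap_component D y \<and> e / 6 \<le> infdist y D" if I: "I \<in> W" for I
  proof -
    obtain x where "x \<notin> D" "I = gap_component D x" "e \<le> diameter I" using I by (auto simp: W_def)
    then show ?thesis using wide_gap_component_deep_point[of x e] assms gap_component_eq by metis
  qed
  then have "\<exists>p. \<forall>I\<in>W. I = gap_component D (p I) \<and> e / 6 \<le> infdist (p I) D"
    by (intro bchoice) blast
  then obtain p where p: "\<And>I. I \<in> W \<Longrightarrow> I = gap_component D (p I)"
    "\<And>I. I \<in> W \<Longrightarrow> e / 6 \<le> infdist (p I) D" by blast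
  \<comment> \<open>The side with respect to \<open>E\<close> is coded by a pair of subsets of
    \<open>E\<close>, so \<open>key\<close> has finitely many values.\<close>
  define key where "key x = ({e \<in> E. e < x}, {e \<in> E. e \<le> x})" for x
  have same_key: "same_side E x y \<longleftrightarrow> key x = key y" for x y
    unfolding same_side_def key_def prod.inject by blast
  have aux: "I = J" if IJ: "I \<in> W" "J \<in> W" "key (p I) = key (p J)" "p I \<le> p J" for I J
  proof (rule ccontr)
    assume "I \<noteq> J"
    then have "p J \<notin> gap_component D (p I)"
      using gap_component_eq[of "p J" D "p I"] p(1)[OF IJ(1)] p(1)[OF IJ(2)] by auto
    then obtain z where z: "z \<in> D" "p I \<le> z" "z \<le> p J"
      using point_between_gap_components IJ(4) by blast
    have "same_side E (p I) (p J)" using same_key IJ by blast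
    \<comment> \<open>\<open>z\<close> lies between two points of one cell, hence in that cell; but
      the distance to \<open>D\<close> is 0 at \<open>z\<close> and at least \<open>e / 6\<close> at
      \<open>p I\<close>.\<close>
    then have "same_side E (p I) z" using z(2,3) unfolding same_side_def
      by (meson less_le_trans order_trans)
    from near[OF this] show False using p(2)[OF IJ(1)] z(1) by simp
  qed
  have "inj_on (\<lambda>I. key (p I)) W"
  proof (rule inj_onI)
    fix I J assume "I \<in> W" "J \<in> W" "key (p I) = key (p J)"
    then show "I = J" using aux[of I J] aux[of J I] linear[of "p I" "p J"] by auto
  qed
  moreover have "(\<lambda>I. key (p I)) ` W \<subseteq> Pow E \<times> Pow E" by (auto simp: key_def)
  ultimately have "finite W" using E by (meson finite_Pow_iff finite_SigmaI inj_on_finite)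
  then show ?thesis by (simp add: W_def)
qed

text \<open>The components form the family. Each has positive diameter, so countability follows by
  writing the family as the union over \<open>n\<close> of the finite families of diameter at least
  \<open>1 / (n + 1)\<close>.\<close>

lemma complement_gap_decomposition:
  "\<exists>\<I> :: 'a set set. countable \<I> \<and> disjoint \<I> \<and> (\<forall>I\<in>\<I>. open_order_interval I) \<and>
     - D = \<Union>\<I> \<and> (\<forall>\<epsilon>>0. finite {I \<in> \<I>. diameter I \<ge> \<epsilon>})"
proof -
  define W where "W = gap_component D ` (- D)"
  have fin: "finite {I \<in> W. diameter I \<ge> e}" if "e > 0" for e
    using finite_wide_gap_components[OF that] by (simp add: W_def)
  have pos: "diameter I > 0" if I: "I \<in> W" for I
  proof -
    obtain x where x: "x \<notin> D" "I = gap_component D x" using I by (auto simp: W_def)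
    then have "open I" "x \<in> I"
      using open_open_order_interval[OF mdlo] open_order_interval_gap_component gap_component_self
      by blast+
    then obtain e where e: "e > 0" "\<And>y. dist y x < e \<Longrightarrow> y \<in> I" unfolding open_dist by blast
    then obtain b where "b > x" "dist x b < e" using exists_right_near[OF mdlo] by blast
    then show ?thesis
      using diameter_bounded_bound[OF bounded_mdlo[OF mdlo], of x I b] e(2)[of b] \<open>x \<in> I\<close>
      by (auto simp: dist_commute intro: less_le_trans[of 0 "dist x b"])
  qed
  have "W \<subseteq> (\<Union>n. {I \<in> W. diameter I \<ge> inverse (real (Suc n))})"
  proof
    fix I assume "I \<in> W"
    with pos obtain n where "inverse (real (Suc n)) < diameter I" using reals_Archimedean by blast
    with \<open>I \<in> W\<close> show "I \<in> (\<Union>n. {I \<in> W. diameter I \<ge> inverse (real (Suc n))})"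
      by (intro UN_I[of n]) auto
  qed
  moreover have "countable (\<Union>n. {I \<in> W. diameter I \<ge> inverse (real (Suc n))})"
    by (intro countable_UN countable_finite[OF fin]) auto
  ultimately have "countable W" by (rule countable_subset)
  moreover have "disjoint W"
    unfolding W_def disjoint_def using gap_component_eq by blast
  moreover have "- D = \<Union>W"
    unfolding W_def using gap_component_self gap_component_disjoint by fastforce
  moreover have "\<forall>I\<in>W. open_order_interval I"
    unfolding W_def using open_order_interval_gap_component by simp
  ultimately show ?thesis using fin by (intro exI[of _ W]) simp
qed

end

section \<open>Definability of small gaps\<close>

text \<open>One formula per error bound suffices: errors \<open>1 / (n + 1)\<close> give the
  uniformly convergent sequence.\<close>

lemma definable_predI:
  assumes "\<And>e. e > 0 \<Longrightarrow> \<exists>(\<phi>::('f, 'p) fm) \<sigma>. wf_fm L \<phi> \<and>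
    (\<forall>x. \<bar>eval_fm M (\<sigma>(0 := x)) \<phi> - P x\<bar> \<le> e)"
  shows "definable_pred L (M::('f, 'p, 'a::metric_space) struct) P"
proof -
  have "\<forall>n. \<exists>(\<phi>::('f, 'p) fm) \<sigma>. wf_fm L \<phi> \<and>
    (\<forall>x. \<bar>eval_fm M (\<sigma>(0 := x)) \<phi> - P x\<bar> \<le> inverse (real (Suc n)))"
    using assms by simp
  then obtain \<phi> :: "nat \<Rightarrow> ('f, 'p) fm" and \<sigma> where wf: "\<And>n. wf_fm L (\<phi> n)"
    and le: "\<And>n x. \<bar>eval_fm M ((\<sigma> n)(0 := x)) (\<phi> n) - P x\<bar> \<le> inverse (real (Suc n))"
    by metis
  have "uniform_limit UNIV (\<lambda>n x. eval_fm M ((\<sigma> n)(0 := x)) (\<phi> n)) P sequentially"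
  proof (rule uniform_limitI)
    fix e :: real assume "e > 0"
    then have "\<forall>\<^sub>F n in sequentially. inverse (real (Suc n)) < e"
      using LIMSEQ_inverse_real_of_nat order_tendstoD(2) by blast
    then show "\<forall>\<^sub>F n in sequentially. \<forall>x\<in>UNIV. dist (eval_fm M ((\<sigma> n)(0 := x)) (\<phi> n)) (P x) < e"
      by eventually_elim (use le in \<open>auto simp: dist_real_def intro: le_less_trans\<close>)
  qed
  with wf show ?thesis unfolding definable_pred_def by blast
qed

lemma connective_const_0: "connective 0 (\<lambda>v. 0)"
  by (auto simp: connective_def)

lemma cube_2: "v \<in> cube 2 \<Longrightarrow> v 0 \<in> {0..1} \<and> v 1 \<in> {0..1}"
  by (simp add: cube_def)

lemma continuous_on_coordinate: "continuous_on S (\<lambda>v::nat \<Rightarrow> real. v i)"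
  by (rule continuous_on_subset[OF continuous_on_product_coordinates subset_UNIV])

lemma connective_max: "connective 2 (\<lambda>v. max (v 0) (v 1))"
  unfolding connective_def
proof (intro conjI image_subsetI)
  show "continuous_on (cube 2) (\<lambda>v. max (v 0) (v 1))"
    by (intro continuous_on_max continuous_on_coordinate)
  show "max (v 0) (v 1) \<in> {0..1}" if "v \<in> cube 2" for v
    using cube_2[OF that] by auto
qed

lemma connective_min: "connective 2 (\<lambda>v. min (v 0) (v 1))"
  unfolding connective_def
proof (intro conjI image_subsetI)
  show "continuous_on (cube 2) (\<lambda>v. min (v 0) (v 1))"
    by (intro continuous_on_min continuous_on_coordinate)
  show "min (v 0) (v 1) \<in> {0..1}" if "v \<in> cube 2" for v
    using cube_2[OF that] by auto
qed

lemma connective_truncated_minus: "connective 2 (\<lambda>v. max 0 (v 0 - v 1))"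
  unfolding connective_def
proof (intro conjI image_subsetI)
  show "continuous_on (cube 2) (\<lambda>v. max 0 (v 0 - v 1))"
    by (intro continuous_on_max continuous_on_const continuous_on_diff continuous_on_coordinate)
  show "max 0 (v 0 - v 1) \<in> {0..1}" if "v \<in> cube 2" for v
    using cube_2[OF that] by auto
qed

section \<open>Formulas for distances to rays and to complements of intervals\<close>

context
  fixes L :: "('f, 'p) lang" and r :: 'p
    and M :: "('f, 'p, 'a::{metric_space, linorder}) struct"
  assumes expansion: "MDLO_expansion L r M"
begin

lemma expansion_mdlo: "MDLO TYPE('a)"
  using expansion by (simp add: MDLO_expansion_def)

lemma ray_eq_infdist: "ray x y = infdist x {..y::'a}"
  by (auto simp: ray_def infdist_notempty)

text \<open>This expresses the distance to an upper ray through the predicate for lower rays. Up to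
  \<open>b\<close> the ray term vanishes and \<open>b\<close> is the nearest point; above
  \<open>b\<close> it equals \<open>dist x b\<close> and cancels.\<close>

lemma infdist_atLeast: "infdist x {b..} = max 0 (dist x b - ray x (b::'a))"
proof (cases "x \<le> b")
  case True
  then have "ray x b = 0" by (simp add: ray_eq_infdist)
  moreover have "infdist x {b..} = dist x b"
  proof (rule antisym)
    show "infdist x {b..} \<le> dist x b" by (rule infdist_le) simp
    show "dist x b \<le> infdist x {b..}"
      using dist_mono_right[OF expansion_mdlo True]
      by (auto simp: infdist_notempty intro!: cINF_greatest)
  qed
  ultimately show ?thesis by simp
next
  case False
  have "ray x b = dist x b"
    unfolding ray_eq_infdist
  proof (rule antisym)
    show "infdist x {..b} \<le> dist x b" by (rule infdist_le) simp
    show "dist x b \<le> infdist x {..b}"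
      using dist_mono_left[OF expansion_mdlo, of _ b x] False
      by (auto simp: infdist_notempty dist_commute intro!: cINF_greatest)
  qed
  then show ?thesis using False by simp
qed

definition ray_fm :: "nat \<Rightarrow> ('f, 'p) fm" where
  "ray_fm j = Pred r [Var 0, Var j]"

text \<open>Truncation at 0 makes subtraction a \<open>[0,1]\<close>-valued connective on the whole
  square.\<close>

definition coray_fm :: "nat \<Rightarrow> ('f, 'p) fm" where
  "coray_fm j = Conn (\<lambda>v. max 0 (v 0 - v 1)) [Dist (Var 0) (Var j), ray_fm j]"

lemma ray_fm: "wf_fm L (ray_fm j)" "eval_fm M \<sigma> (ray_fm j) = infdist (\<sigma> 0) {..\<sigma> j}"
  using expansion by (auto simp: ray_fm_def MDLO_expansion_def ray_eq_infdist)

lemma coray_fm: "wf_fm L (coray_fm j)" "eval_fm M \<sigma> (coray_fm j) = infdist (\<sigma> 0) {\<sigma> j..}"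
  using connective_truncated_minus ray_fm(1)[of j] ray_fm(2)[of \<sigma> j]
  by (simp_all add: coray_fm_def infdist_atLeast ray_eq_infdist numeral_2_eq_2)

text \<open>The complement is a ray or a union of two, and the distance to a union is the minimum.
  The parameters are fixed before the variables \<open>j\<close> and \<open>k\<close>, so that
  several intervals can be given separate variables.\<close>

lemma open_order_interval_formula:
  fixes I :: "'a set"
  assumes "open_order_interval I" "I \<noteq> UNIV"
  shows "\<exists>a b. \<forall>j k. \<exists>\<phi>::('f, 'p) fm. wf_fm L \<phi> \<and>
    (\<forall>\<sigma>. \<sigma> j = a \<longrightarrow> \<sigma> k = b \<longrightarrow> eval_fm M \<sigma> \<phi> = infdist (\<sigma> 0) (- I))"
proof -
  consider a b where "I = {a<..<b}" | a where "I = {a<..}" | b where "I = {..<b}"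
    using assms unfolding open_order_interval_def by blast
  then show ?thesis
  proof cases
    case (1 a b)
    then have I: "- I = {..a} \<union> {b..}" by auto
    have "infdist x (- I) = min (infdist x {..a}) (infdist x {b..})" for x
      unfolding I by (rule infdist_Un_min) auto
    then show ?thesis
      using connective_min ray_fm coray_fm
      by (intro exI[of _ a] exI[of _ b] allI,
          intro exI[of _ "Conn (\<lambda>v. min (v 0) (v 1)) [ray_fm _, coray_fm _]"])
        (auto simp: numeral_2_eq_2)
  next
    case (2 a)
    then have I: "- I = {..a}" by auto
    show ?thesis unfolding I using ray_fm by metis
  next
    case (3 b)
    then have I: "- I = {b..}" by auto
    show ?thesis unfolding I using coray_fm by metis
  qed
qed

text \<open>Variable 0 is kept for the argument and parameters sit in variables 1 to
  \<open>N\<close>. Quantifying over all assignments that agree with \<open>\<tau>\<close> there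
  lets the induction add parameters without disturbing the formula already built. The inserted 0
  gives \<open>Max\<close> a value for empty \<open>S\<close>.\<close>

lemma finite_max_formula:
  fixes S :: "'a set set"
  assumes "finite S" "\<forall>I\<in>S. open_order_interval I" "UNIV \<notin> S"
  shows "\<exists>(\<phi>::('f, 'p) fm) N \<tau>. wf_fm L \<phi> \<and> (\<forall>\<sigma>. (\<forall>i\<in>{1..N}. \<sigma> i = \<tau> i) \<longrightarrow>
    eval_fm M \<sigma> \<phi> = Max (insert 0 ((\<lambda>I. infdist (\<sigma> 0) (- I)) ` S)))"
  using assms
proof (induction S rule: finite_induct)
  case empty
  show ?case
    by (intro exI[of _ "Conn (\<lambda>v. 0) []"]) (simp add: connective_const_0)
next
  case (insert I S)
  have "\<forall>I\<in>S. open_order_interval I" "UNIV \<notin> S" using insert.prems by auto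
  from insert.IH[OF this] obtain \<phi> :: "('f, 'p) fm" and N \<tau> where
    \<phi>: "wf_fm L \<phi> \<and> (\<forall>\<sigma>. (\<forall>i\<in>{1..N}. \<sigma> i = \<tau> i) \<longrightarrow>
      eval_fm M \<sigma> \<phi> = Max (insert 0 ((\<lambda>I. infdist (\<sigma> 0) (- I)) ` S)))"
    by (elim exE) (rule that)
  have "open_order_interval I" "I \<noteq> UNIV" using insert.prems by auto
  from open_order_interval_formula[OF this] obtain a b where
    "\<forall>j k. \<exists>\<phi>::('f, 'p) fm. wf_fm L \<phi> \<and>
      (\<forall>\<sigma>. \<sigma> j = a \<longrightarrow> \<sigma> k = b \<longrightarrow> eval_fm M \<sigma> \<phi> = infdist (\<sigma> 0) (- I))"
    by (elim exE) (rule that)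
  \<comment> \<open>The two endpoints of the new interval go into the fresh variables
    \<open>N + 1\<close> and \<open>N + 2\<close>.\<close>
  from spec[OF spec[OF this, of "N + 1"], of "N + 2"] obtain \<psi> :: "('f, 'p) fm" where
    \<psi>: "wf_fm L \<psi> \<and> (\<forall>\<sigma>. \<sigma> (N + 1) = a \<longrightarrow> \<sigma> (N + 2) = b \<longrightarrow>
      eval_fm M \<sigma> \<psi> = infdist (\<sigma> 0) (- I))"
    by (elim exE) (rule that)
  define \<theta> where "\<theta> = Conn (\<lambda>v. max (v 0) (v 1)) [\<psi>, \<phi>]"
  define \<tau>' where "\<tau>' = \<tau>(N + 1 := a, N + 2 := b)"
  have "wf_fm L \<theta>" using connective_max \<phi> \<psi> by (simp add: \<theta>_def numeral_2_eq_2)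
  moreover have "eval_fm M \<sigma> \<theta> = Max (insert 0 ((\<lambda>I. infdist (\<sigma> 0) (- I)) ` insert I S))"
    if \<sigma>: "\<forall>i\<in>{1..N + 2}. \<sigma> i = \<tau>' i" for \<sigma>
  proof -
    have "\<forall>i\<in>{1..N}. \<sigma> i = \<tau> i" "\<sigma> (N + 1) = a" "\<sigma> (N + 2) = b"
      using \<sigma> by (auto simp: \<tau>'_def)
    then have "eval_fm M \<sigma> \<theta> = max (infdist (\<sigma> 0) (- I))
        (Max (insert 0 ((\<lambda>I. infdist (\<sigma> 0) (- I)) ` S)))"
      using \<phi> \<psi> by (simp add: \<theta>_def)
    also have "\<dots> = Max (insert (infdist (\<sigma> 0) (- I)) (insert 0 ((\<lambda>I. infdist (\<sigma> 0) (- I)) ` S)))"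
      using insert.hyps(1) by (intro Max_insert[symmetric]) auto
    finally show ?thesis
      unfolding image_insert insert_commute[of "infdist (\<sigma> 0) (- I)" 0] .
  qed
  ultimately show ?case
    by (intro exI[of _ \<theta>] exI[of _ "N + 2"] exI[of _ \<tau>'] conjI allI impI)
qed

section \<open>The distance function recovered from the gaps\<close>

context
  fixes D :: "'a set" and \<I> :: "'a set set"
  assumes disj: "disjoint \<I>" and ivl: "\<And>I. I \<in> \<I> \<Longrightarrow> open_order_interval I"
    and compl: "- D = \<Union>\<I>" and nonempty: "D \<noteq> {}"
begin

text \<open>Otherwise \<open>e\<close> would lie in an open member of the family that meets
  \<open>I\<close> and so equals \<open>I\<close> by disjointness.\<close>

lemma gap_boundary:
  assumes "I \<in> \<I>" "e \<in> closure I" "e \<notin> I"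
  shows "e \<in> D"
proof (rule ccontr)
  assume "e \<notin> D"
  then obtain J where J: "J \<in> \<I>" "e \<in> J" using compl by blast
  then have "J \<inter> I \<noteq> {}"
    using open_open_order_interval[OF expansion_mdlo ivl] assms(2) open_Int_closure_eq_empty by blast
  then have "I = J" using disj J(1) assms(1) by (auto simp: disjoint_def)
  then show False using J assms by simp
qed

text \<open>Leaving \<open>I\<close> from \<open>x\<close> means passing a boundary point of
  \<open>I\<close>, which is in \<open>D\<close> and no farther; so the rest of \<open>D\<close>
  does not affect the distance.\<close>

lemma infdist_gap:
  assumes "I \<in> \<I>" "x \<in> I"
  shows "infdist x D = infdist x (- I)" "infdist x (- I) \<le> diameter I"
proof -
  have sub: "D \<subseteq> - I" using assms(1) compl by blast
  then have ne: "- I \<noteq> {}" using nonempty by blast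
  have near: "\<exists>e\<in>D. e \<in> closure I \<and> dist x e \<le> dist x z" if "z \<in> - I" for z
    using open_order_interval_nearest_boundary[OF expansion_mdlo ivl[OF assms(1)] assms(2)]
      gap_boundary[OF assms(1)] that by fastforce
  have "infdist x D \<le> dist x z" if "z \<in> - I" for z
    using near[OF that] infdist_le2 by blast
  then have "infdist x D \<le> infdist x (- I)"
    using ne by (auto simp: infdist_notempty[OF ne] intro!: cINF_greatest)
  then show "infdist x D = infdist x (- I)"
    using infdist_mono[OF sub nonempty, of x] by simp
  obtain e where e: "e \<in> D" "e \<in> closure I" using near ne by blast
  have "infdist x (- I) \<le> dist x e" using e(1) sub by (intro infdist_le) auto
  also have "\<dots> \<le> diameter (closure I)"
    using assms(2) e(2) closure_subset
    by (intro diameter_bounded_bound bounded_mdlo[OF expansion_mdlo]) auto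
  \<comment> \<open>The boundary point \<open>e\<close> is only in the closure of \<open>I\<close>,
    which has the same diameter.\<close>
  also have "\<dots> = diameter I"
    by (rule diameter_closure[OF bounded_mdlo[OF expansion_mdlo]])
  finally show "infdist x (- I) \<le> diameter I" .
qed

text \<open>At most the gap containing \<open>x\<close> contributes a nonzero term. If that gap is
  not in \<open>S\<close>, the maximum is 0 while the true distance is at most its diameter, hence
  at most \<open>e\<close>.\<close>

lemma infdist_approx_wide_gaps:
  assumes "finite S" "S \<subseteq> \<I>" "\<And>I. I \<in> \<I> - S \<Longrightarrow> diameter I \<le> e" "e > 0"
  shows "\<bar>Max (insert 0 ((\<lambda>I. infdist x (- I)) ` S)) - infdist x D\<bar> \<le> e"
proof (cases "x \<in> D")
  case True
  then have "x \<in> - I" if "I \<in> S" for I using that assms(2) compl by blast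
  then have "insert 0 ((\<lambda>I. infdist x (- I)) ` S) = {0}" by auto
  then have "Max (insert 0 ((\<lambda>I. infdist x (- I)) ` S)) = 0" by (simp only: Max_singleton)
  then show ?thesis using True assms(4) by simp
next
  case False
  then obtain I where I: "I \<in> \<I>" "x \<in> I" using compl by blast
  have out: "infdist x (- J) = 0" if "J \<in> S" "J \<noteq> I" for J
  proof -
    have "J \<inter> I = {}" using disj that assms(2) I(1) by (auto simp: disjoint_def)
    then have "x \<in> - J" using I(2) by auto
    then show ?thesis by (rule infdist_zero)
  qed
  show ?thesis
  proof (cases "I \<in> S")
    case True
    have "insert 0 ((\<lambda>I. infdist x (- I)) ` S) = {0, infdist x (- I)}" using True out by auto
    then have "Max (insert 0 ((\<lambda>I. infdist x (- I)) ` S)) = max 0 (infdist x (- I))"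
      by (metis Max_insert Max_singleton finite.intros insert_not_empty)
    then show ?thesis using infdist_gap(1)[OF I] assms(4) by (simp add: infdist_nonneg)
  next
    case False
    then have "insert 0 ((\<lambda>I. infdist x (- I)) ` S) = {0}" using out by auto
    then have "Max (insert 0 ((\<lambda>I. infdist x (- I)) ` S)) = 0" by (simp only: Max_singleton)
    then show ?thesis
      using infdist_gap[OF I] assms(3)[of I] I(1) False by (simp add: infdist_nonneg)
  qed
qed

lemma definable_set_of_gaps:
  assumes "\<And>e. e > 0 \<Longrightarrow> finite {I \<in> \<I>. diameter I \<ge> e}"
  shows "definable_set L M D"
proof -
  have "open (- D)"
    unfolding compl using open_open_order_interval[OF expansion_mdlo ivl] by blast
  then have "closed D" by (simp add: closed_def)
  moreover have "definable_pred L M (\<lambda>x. infdist x D)"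
  proof (rule definable_predI)
    fix e :: real assume "e > 0"
    define S where "S = {I \<in> \<I>. diameter I \<ge> e}"
    have S: "finite S" "S \<subseteq> \<I>" "UNIV \<notin> S"
      using assms[OF \<open>e > 0\<close>] nonempty compl by (auto simp: S_def)
    have "\<forall>I\<in>S. open_order_interval I" using S(2) ivl by auto
    from finite_max_formula[OF S(1) this S(3)] obtain \<phi> :: "('f, 'p) fm" and N \<tau> where
      \<phi>: "wf_fm L \<phi> \<and> (\<forall>\<sigma>. (\<forall>i\<in>{1..N}. \<sigma> i = \<tau> i) \<longrightarrow>
        eval_fm M \<sigma> \<phi> = Max (insert 0 ((\<lambda>I. infdist (\<sigma> 0) (- I)) ` S)))"
      by (elim exE) (rule that)
    have "diameter I \<le> e" if "I \<in> \<I> - S" for I using that by (auto simp: S_def)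
    \<comment> \<open>\<open>\<tau>(0 := x)\<close> agrees with \<open>\<tau>\<close> on the
      parameter variables, which start at 1; so one formula serves all \<open>x\<close>.\<close>
    then have "\<bar>eval_fm M (\<tau>(0 := x)) \<phi> - infdist x D\<bar> \<le> e" for x
      using \<phi> infdist_approx_wide_gaps[OF S(1,2) _ \<open>e > 0\<close>, of x]
      by simp
    with \<phi> show "\<exists>(\<phi>::('f, 'p) fm) \<sigma>. wf_fm L \<phi> \<and>
      (\<forall>x. \<bar>eval_fm M (\<sigma>(0 := x)) \<phi> - infdist x D\<bar> \<le> e)"
      by (intro exI[of _ \<phi>] exI[of _ \<tau>]) simp
  qed
  ultimately show ?thesis using nonempty by (simp add: definable_set_def)
qed

end

end

text \<open>For empty \<open>D\<close> the right side would hold with the single interval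
  \<open>UNIV\<close>, whereas a definable set is nonempty by definition.\<close>

theorem theorem7p12:
  fixes L :: "('f, 'p) lang" and r :: 'p
    and M :: "('f, 'p, 'a::{metric_space, linorder}) struct"
    and D :: "'a set"
  assumes "MDLO_expansion L r M"
    and "o_minimal L M"
    and "D \<noteq> {}"
  shows "definable_set L M D \<longleftrightarrow>
    (\<exists>\<I> :: 'a set set. countable \<I> \<and> disjoint \<I> \<and> (\<forall>I\<in>\<I>. open_order_interval I) \<and>
       - D = \<Union>\<I> \<and> (\<forall>\<epsilon>>0. finite {I \<in> \<I>. diameter I \<ge> \<epsilon>}))"
proof
  assume "definable_set L M D"
  then have "closed D" "strongly_regulated (\<lambda>x. infdist x D)"
    using assms(2) by (auto simp: definable_set_def o_minimal_def)
  with assms(3) show "\<exists>\<I> :: 'a set set. countable \<I> \<and> disjoint \<I> \<and>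
       (\<forall>I\<in>\<I>. open_order_interval I) \<and>
       - D = \<Union>\<I> \<and> (\<forall>\<epsilon>>0. finite {I \<in> \<I>. diameter I \<ge> \<epsilon>})"
    by (intro complement_gap_decomposition[OF expansion_mdlo[OF assms(1)]])
next
  assume "\<exists>\<I> :: 'a set set. countable \<I> \<and> disjoint \<I> \<and> (\<forall>I\<in>\<I>. open_order_interval I) \<and>
       - D = \<Union>\<I> \<and> (\<forall>\<epsilon>>0. finite {I \<in> \<I>. diameter I \<ge> \<epsilon>})"
  then obtain \<I> :: "'a set set" where "disjoint \<I>" "\<forall>I\<in>\<I>. open_order_interval I"
    "- D = \<Union>\<I>" "\<forall>\<epsilon>>0. finite {I \<in> \<I>. diameter I \<ge> \<epsilon>}"
    by blast
  then show "definable_set L M D"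
    using assms(3) by (intro definable_set_of_gaps[OF assms(1), of \<I>]) simp_all
qed

end
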